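(* Let $k$ be a positive integer and let $v$ be a positive integer such that both $v-1$ and $v+1$ are primes. Then there exists no Pythagorean triple that has the reciprocal property $R(v,k,1)$.
   Context: A Pythagorean triple is a triple $(a,b,c)$ of positive integers with $a^2+b^2=c^2$ ($a,b$ are the leg lengths and $c$ the hypotenuse length of a right triangle). Let $h=ab/c$ be the altitude to the hypotenuse of this triangle. For positive integers $v,k,l$ with $\gcd(k,l)=1$, the triple $(a,b,c)$ is said to have the reciprocal property $R(v,k,l)$ if $$\frac1a+\frac1b+\frac{v}{h}=\frac{k}{l}.$$ *)

theory Defs
  imports Complex_Main "HOL-Computational_Algebra.Primes"
begin

definition pythagorean_triple :: "nat \<Rightarrow> nat \<Rightarrow> nat \<Rightarrow> bool" where
  "pythagorean_triple a b c \<longleftrightarrow> a > 0 \<and> b > 0 \<and> c > 0 \<and> a\<^sup>2 + b\<^sup>2 = c\<^sup>2"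

definition altitude :: "nat \<Rightarrow> nat \<Rightarrow> nat \<Rightarrow> real" where
  "altitude a b c = real a * real b / real c"

text \<open>
  The property R(v,k,l) of the triple (a,b,c). It is only meant for positive v, k, l with k and l
  coprime; these are conditions on the parameters, not on the triple, and are therefore
  hypotheses wherever the property is used.
\<close>

definition reciprocal_property ::
  "nat \<Rightarrow> nat \<Rightarrow> nat \<Rightarrow> nat \<Rightarrow> nat \<Rightarrow> nat \<Rightarrow> bool" where
  "reciprocal_property v k l a b c \<longleftrightarrow>
     1 / real a + 1 / real b + real v / altitude a b c = real k / real l"

end

theory Submission imports Defs begin

text \<open>
  Clearing denominators gives \<open>a + b + v c = k a b\<close>, and dividing by \<open>gcd a b\<close> one may take the
  triple to be primitive while \<open>a b\<close> still divides \<open>a + b + v c\<close>. Modulo \<open>a\<close> we have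
  \<open>b = - v c\<close> and \<open>c\<^sup>2 = b\<^sup>2\<close>, so \<open>b\<^sup>2 = v\<^sup>2 b\<^sup>2\<close> and hence \<open>a\<close> divides \<open>v\<^sup>2 - 1\<close>; likewise
  for \<open>b\<close>. One of the legs is even, but \<open>v\<^sup>2 - 1\<close> is odd because two primes that differ by 2
  are odd.
\<close>

lemma leg_dvd_square_minus_one:
  fixes a b c v :: int
  assumes "a\<^sup>2 + b\<^sup>2 = c\<^sup>2" and "coprime a b" and "a dvd b + v * c"
  shows "a dvd v\<^sup>2 - 1"
proof -
  \<comment> \<open>The subtracted multiple of \<open>a\<close> is chosen so that replacing
    \<open>c\<^sup>2\<close> by \<open>a\<^sup>2 + b\<^sup>2\<close> leaves exactly
    \<open>(v\<^sup>2 - 1) * b\<^sup>2\<close>; coprimality then removes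
    \<open>b\<^sup>2\<close>.\<close>
  have "a dvd (b + v * c) * (v * c - b) - a * (a * v\<^sup>2)"
    using assms(3) by (intro dvd_diff dvd_mult2 dvd_triv_left)
  also have "(b + v * c) * (v * c - b) - a * (a * v\<^sup>2) = v\<^sup>2 * c\<^sup>2 - b\<^sup>2 - v\<^sup>2 * a\<^sup>2"
    by (simp add: algebra_simps power2_eq_square)
  also have "\<dots> = (v\<^sup>2 - 1) * b\<^sup>2"
    unfolding assms(1)[symmetric] by (simp add: algebra_simps)
  finally show ?thesis
    using assms(2) by (simp add: coprime_dvd_mult_left_iff)
qed

text \<open>Two odd squares sum to 2 modulo 4, whereas an even square is 0 modulo 4.\<close>

lemma pythagorean_even_leg:
  fixes a b c :: int
  assumes "a\<^sup>2 + b\<^sup>2 = c\<^sup>2"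
  shows "even a \<or> even b"
proof (rule ccontr)
  assume "\<not> (even a \<or> even b)"
  then obtain i j where ij: "a = 2 * i + 1" "b = 2 * j + 1"
    by (meson oddE)
  have "even (c\<^sup>2)"
    unfolding assms[symmetric] ij by simp
  then obtain m where "c = 2 * m"
    by (auto elim: evenE)
  with assms ij have "4 * (i * i + i + j * j + j) + 2 = 4 * (m * m)"
    by (simp add: power2_eq_square algebra_simps)
  then show False
    by presburger
qed

lemma not_product_dvd_of_even:
  fixes a b c v :: int
  assumes pyth: "a\<^sup>2 + b\<^sup>2 = c\<^sup>2" and cop: "coprime a b" and "even v"
  shows "\<not> a * b dvd a + b + v * c"
proof
  assume dvd: "a * b dvd a + b + v * c"
  have "a dvd a + (b + v * c)" "b dvd b + (a + v * c)"
    using dvd_mult_left[OF dvd] dvd_mult_right[OF dvd] by (simp_all add: ac_simps)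
  then have "a dvd b + v * c" "b dvd a + v * c"
    by (simp_all only: dvd_add_triv_left_iff)
  then have "a dvd v\<^sup>2 - 1" "b dvd v\<^sup>2 - 1"
    using leg_dvd_square_minus_one[of a b c v] leg_dvd_square_minus_one[of b a c v] pyth cop
    by (simp_all add: ac_simps)
  then have "even (v\<^sup>2 - 1)"
    using pythagorean_even_leg[OF pyth] dvd_trans by blast
  with \<open>even v\<close> show False
    by simp
qed

text \<open>Since the altitude is \<open>a * b / c\<close>, the term \<open>v / h\<close> equals
  \<open>v * c / (a * b)\<close>, so multiplying by \<open>a * b\<close> clears every
  denominator.\<close>

lemma reciprocal_property_cleared:
  assumes "pythagorean_triple a b c" and "reciprocal_property v k 1 a b c"
  shows "a + b + v * c = k * (a * b)"
proof -
  have pos: "real a > 0" "real b > 0"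
    using assms(1) by (simp_all add: pythagorean_triple_def)
  have "real (a + b + v * c) =
      (1 / real a + 1 / real b + real v / altitude a b c) * (real a * real b)"
    using pos by (simp add: altitude_def field_simps)
  also have "\<dots> = real (k * (a * b))"
    using assms(2) by (simp add: reciprocal_property_def)
  finally have "real (a + b + v * c) = real (k * (a * b))" .
  then show ?thesis
    by (simp only: of_nat_eq_iff)
qed

theorem theorem3:
  fixes v k :: nat
  assumes "k > 0" and "v > 0" and "prime (v - 1)" and "prime (v + 1)"
  shows "\<not> (\<exists>a b c. pythagorean_triple a b c \<and> reciprocal_property v k 1 a b c)"
proof
  assume "\<exists>a b c. pythagorean_triple a b c \<and> reciprocal_property v k 1 a b c"
  then obtain a b c where triple: "pythagorean_triple a b c"
    and recip: "reciprocal_property v k 1 a b c"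
    by blast
  \<comment> \<open>A prime \<open>v - 1\<close> exceeds 1, which rules out
    \<open>v + 1 = 2\<close>, so the prime \<open>v + 1\<close> is odd.\<close>
  have "v > 2"
    using prime_gt_1_nat[OF assms(3)] by simp
  then have "even v"
    using prime_odd_nat[OF assms(4)] by simp
  define d where "d = gcd a b"
  have "d > 0" and pyth: "a\<^sup>2 + b\<^sup>2 = c\<^sup>2"
    using triple by (auto simp: d_def pythagorean_triple_def)
  obtain a' b' where ab: "a = a' * d" "b = b' * d" and "coprime a' b'"
    using gcd_coprime_exists[of a b] \<open>d > 0\<close> unfolding d_def by blast
  have "d\<^sup>2 dvd c\<^sup>2"
    unfolding pyth[symmetric] ab by (simp add: power_mult_distrib)
  then have "d dvd c"
    by simp
  then obtain c' where c: "c = c' * d"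
    by (metis dvdE mult.commute)
  have "(a'\<^sup>2 + b'\<^sup>2) * d\<^sup>2 = c'\<^sup>2 * d\<^sup>2"
    using pyth by (simp add: ab c power_mult_distrib algebra_simps)
  then have pyth': "a'\<^sup>2 + b'\<^sup>2 = c'\<^sup>2"
    using \<open>d > 0\<close> by simp
  \<comment> \<open>The left side is linear in the sides and the right side quadratic, so a factor
    \<open>d\<close> survives cancellation; it is absorbed by passing to divisibility.\<close>
  have "(a' + b' + v * c') * d = (k * d * (a' * b')) * d"
    using reciprocal_property_cleared[OF triple recip] by (simp add: ab c algebra_simps)
  then have "a' * b' dvd a' + b' + v * c'"
    using \<open>d > 0\<close> by simp
  \<comment> \<open>The divisibility argument uses differences such as \<open>v * c - b\<close>,
    hence the passage to integers.\<close>
  then have "int a' * int b' dvd int a' + int b' + int v * int c'"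
    by (simp flip: of_nat_mult of_nat_add)
  moreover have "(int a')\<^sup>2 + (int b')\<^sup>2 = (int c')\<^sup>2"
    using pyth' by (simp flip: of_nat_power of_nat_add)
  ultimately show False
    using not_product_dvd_of_even[of "int a'" "int b'" "int c'" "int v"]
      \<open>coprime a' b'\<close> \<open>even v\<close>
    by simp
qed

end
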